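(* For each $1\leq p<\infty$, the metric space $(\mathcal{M}_p,d_{\mathrm{GH}}^{(p)})$ is complete and separable.
   Context: All metric spaces are nonempty. For $p\in[1,\infty)$, a $p$-metric space is a metric space satisfying $d(x,x'')^p\le d(x,x')^p+d(x',x'')^p$ for all points; $\mathcal{M}_p$ is the collection of isometry classes of compact $p$-metric spaces. For metric spaces $X,Y$, $$d_{\mathrm{GH}}^{(p)}(X,Y)=2^{-\frac1p}\inf_R\ \sup_{(x,y),(x',y')\in R}\left|d_X(x,x')^p-d_Y(y,y')^p\right|^{\frac1p},$$ with $R$ ranging over all correspondences between $X$ and $Y$ (subsets of $X\times Y$ projecting onto both factors); this defines a metric on $\mathcal{M}_p$. *)

theory Defs
  imports "HOL-Analysis.Analysis"
begin

definition p_metric_space :: "real \<Rightarrow> 'a metric \<Rightarrow> bool" where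
  "p_metric_space p X \<longleftrightarrow>
     (\<forall>x\<in>mspace X. \<forall>x'\<in>mspace X. \<forall>x''\<in>mspace X.
        mdist X x x'' powr p \<le> mdist X x x' powr p + mdist X x' x'' powr p)"

definition isometric :: "'a metric \<Rightarrow> 'b metric \<Rightarrow> bool" where
  "isometric X Y \<longleftrightarrow>
     (\<exists>f. bij_betw f (mspace X) (mspace Y) \<and>
          (\<forall>x\<in>mspace X. \<forall>x'\<in>mspace X. mdist Y (f x) (f x') = mdist X x x'))"

definition correspondence :: "('a \<times> 'b) set \<Rightarrow> 'a set \<Rightarrow> 'b set \<Rightarrow> bool" where
  "correspondence R A B \<longleftrightarrow> R \<subseteq> A \<times> B \<and> fst ` R = A \<and> snd ` R = B"

text \<open>Valued in \<^typ>\<open>ennreal\<close>, so that infimum and supremum are meaningful for arbitrary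
  metric spaces; the value is finite on compact ones, see \<open>dGH_finite\<close>.\<close>

definition dGH :: "real \<Rightarrow> 'a metric \<Rightarrow> 'b metric \<Rightarrow> ennreal" where
  "dGH p X Y = ennreal (2 powr (- (1 / p))) *
     (INF R \<in> {R. correspondence R (mspace X) (mspace Y)}.
        SUP ((x, y), (x', y')) \<in> R \<times> R.
          ennreal (\<bar>mdist X x x' powr p - mdist Y y y' powr p\<bar> powr (1 / p)))"

text \<open>Isometry classes are formed within the metric spaces whose points are real numbers.
  No class is lost: a compact metric space has at most continuum many points, so it has an
  isometric copy of this kind, see \<open>compact_metric_real_copy\<close>.\<close>

definition compact_p_metrics :: "real \<Rightarrow> real metric set" where
  "compact_p_metrics p =
     {X. mspace X \<noteq> {} \<and> compact_space (mtopology_of X) \<and> p_metric_space p X}"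

definition Mp :: "real \<Rightarrow> real metric set set" where
  "Mp p = compact_p_metrics p //
            {(X, Y). X \<in> compact_p_metrics p \<and> Y \<in> compact_p_metrics p \<and> isometric X Y}"

text \<open>The choice of representatives is irrelevant, see \<open>dGH_Mp_eq\<close>.\<close>

definition dGH_Mp :: "real \<Rightarrow> real metric set \<Rightarrow> real metric set \<Rightarrow> real" where
  "dGH_Mp p A B = enn2real (dGH p (SOME X. X \<in> A) (SOME Y. Y \<in> B))"


subsection \<open>Sanity checks\<close>

lemma isometric_refl: "isometric X X"
  unfolding isometric_def by (rule exI[of _ id]) auto

lemma isometric_sym:
  assumes "isometric X Y" shows "isometric Y X"
proof -
  obtain f where f: "bij_betw f (mspace X) (mspace Y)"
    "\<And>x x'. x \<in> mspace X \<Longrightarrow> x' \<in> mspace X \<Longrightarrow> mdist Y (f x) (f x') = mdist X x x'"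
    using assms unfolding isometric_def by blast
  let ?g = "inv_into (mspace X) f"
  have "bij_betw ?g (mspace Y) (mspace X)" using f(1) by (rule bij_betw_inv_into)
  moreover have "mdist X (?g y) (?g y') = mdist Y y y'" if "y \<in> mspace Y" "y' \<in> mspace Y" for y y'
    using f(2)[of "?g y" "?g y'"] that bij_betw_inv_into_right[OF f(1)]
      bij_betwE[OF bij_betw_inv_into[OF f(1)]] by auto
  ultimately show ?thesis unfolding isometric_def by blast
qed

lemma isometric_trans:
  assumes "isometric X Y" "isometric Y Z" shows "isometric X Z"
proof -
  obtain f where f: "bij_betw f (mspace X) (mspace Y)"
    "\<And>x x'. x \<in> mspace X \<Longrightarrow> x' \<in> mspace X \<Longrightarrow> mdist Y (f x) (f x') = mdist X x x'"
    using assms unfolding isometric_def by blast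
  obtain g where g: "bij_betw g (mspace Y) (mspace Z)"
    "\<And>x x'. x \<in> mspace Y \<Longrightarrow> x' \<in> mspace Y \<Longrightarrow> mdist Z (g x) (g x') = mdist Y x x'"
    using assms unfolding isometric_def by blast
  show ?thesis unfolding isometric_def
    by (rule exI[of _ "g \<circ> f"])
      (use f g bij_betw_trans[OF f(1) g(1)] bij_betwE[OF f(1)] in auto)
qed

lemma equiv_isometric:
  "equiv (compact_p_metrics p)
     {(X, Y). X \<in> compact_p_metrics p \<and> Y \<in> compact_p_metrics p \<and> isometric X Y}"
  by (rule equivI)
    (auto simp: refl_on_def sym_def trans_def isometric_refl
      intro: isometric_sym isometric_trans)

lemma fst_converse: "fst ` (R\<inverse>) = snd ` R"
  by force

lemma snd_converse: "snd ` (R\<inverse>) = fst ` R"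
  by force

lemma dGH_commute_le: "dGH p X Y \<le> dGH p Y X"
  unfolding dGH_def
proof (intro mult_left_mono INF_greatest)
  fix R assume "R \<in> {R. correspondence R (mspace Y) (mspace X)}"
  then have R: "correspondence (R\<inverse>) (mspace X) (mspace Y)"
    unfolding correspondence_def by (auto simp: fst_converse snd_converse)
  have "(SUP ((x, y), (x', y')) \<in> R\<inverse> \<times> R\<inverse>.
          ennreal (\<bar>mdist X x x' powr p - mdist Y y y' powr p\<bar> powr (1 / p)))
      \<le> (SUP ((x, y), (x', y')) \<in> R \<times> R.
          ennreal (\<bar>mdist Y x x' powr p - mdist X y y' powr p\<bar> powr (1 / p)))"
  proof (rule SUP_least)
    fix z assume "z \<in> R\<inverse> \<times> R\<inverse>"
    then obtain a b a' b' where z: "z = ((a, b), (a', b'))" "(b, a) \<in> R" "(b', a') \<in> R" by auto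
    show "(\<lambda>((x, y), (x', y')).
            ennreal (\<bar>mdist X x x' powr p - mdist Y y y' powr p\<bar> powr (1 / p))) z
        \<le> (SUP ((x, y), (x', y')) \<in> R \<times> R.
            ennreal (\<bar>mdist Y x x' powr p - mdist X y y' powr p\<bar> powr (1 / p)))"
      by (rule SUP_upper2[of "((b, a), (b', a'))"]) (use z in \<open>auto simp: abs_minus_commute\<close>)
  qed
  then show "(INF R \<in> {R. correspondence R (mspace X) (mspace Y)}.
      SUP ((x, y), (x', y')) \<in> R \<times> R.
          ennreal (\<bar>mdist X x x' powr p - mdist Y y y' powr p\<bar> powr (1 / p)))
      \<le> (SUP ((x, y), (x', y')) \<in> R \<times> R.
          ennreal (\<bar>mdist Y x x' powr p - mdist X y y' powr p\<bar> powr (1 / p)))"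
    by (intro INF_lower2[of "R\<inverse>"]) (use R in auto)
qed auto

lemma dGH_commute: "dGH p X Y = dGH p Y X"
  by (rule antisym; rule dGH_commute_le)

lemma dGH_isometric_left_le:
  assumes iso: "isometric X X'" shows "dGH p X Y \<le> dGH p X' Y"
  unfolding dGH_def
proof (intro mult_left_mono INF_greatest)
  obtain f where f: "bij_betw f (mspace X) (mspace X')"
    "\<And>x x'. x \<in> mspace X \<Longrightarrow> x' \<in> mspace X \<Longrightarrow> mdist X' (f x) (f x') = mdist X x x'"
    using iso unfolding isometric_def by blast
  fix R assume "R \<in> {R. correspondence R (mspace X') (mspace Y)}"
  then have R: "R \<subseteq> mspace X' \<times> mspace Y" "fst ` R = mspace X'" "snd ` R = mspace Y"
    by (auto simp: correspondence_def)
  let ?S = "{(x, y). x \<in> mspace X \<and> (f x, y) \<in> R}"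
  have im: "f ` mspace X = mspace X'" using f(1) by (simp add: bij_betw_def)
  have "fst ` ?S = mspace X"
  proof
    show "mspace X \<subseteq> fst ` ?S"
    proof
      fix x assume x: "x \<in> mspace X"
      then have "f x \<in> fst ` R" using im R(2) by auto
      then obtain y where "(f x, y) \<in> R" by auto
      then show "x \<in> fst ` ?S" using x by (auto simp: image_iff)
    qed
  qed auto
  moreover have "snd ` ?S = mspace Y"
  proof
    show "snd ` ?S \<subseteq> mspace Y" using R(1) by auto
    show "mspace Y \<subseteq> snd ` ?S"
    proof
      fix y assume "y \<in> mspace Y"
      then obtain x' where x': "(x', y) \<in> R" using R(3) by force
      then have "x' \<in> f ` mspace X" unfolding im using R(1) by auto
      then obtain x where "x \<in> mspace X" "f x = x'" by blast
      then show "y \<in> snd ` ?S" using x' by (auto simp: image_iff)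
    qed
  qed
  moreover have "?S \<subseteq> mspace X \<times> mspace Y" using R(1) by auto
  ultimately have S: "correspondence ?S (mspace X) (mspace Y)"
    unfolding correspondence_def by blast
  have "(SUP ((x, y), (x', y')) \<in> ?S \<times> ?S.
          ennreal (\<bar>mdist X x x' powr p - mdist Y y y' powr p\<bar> powr (1 / p)))
      \<le> (SUP ((x, y), (x', y')) \<in> R \<times> R.
          ennreal (\<bar>mdist X' x x' powr p - mdist Y y y' powr p\<bar> powr (1 / p)))"
  proof (rule SUP_least)
    fix z assume "z \<in> ?S \<times> ?S"
    then obtain a b a' b' where z: "z = ((a, b), (a', b'))" "a \<in> mspace X" "a' \<in> mspace X"
        "(f a, b) \<in> R" "(f a', b') \<in> R"
      by auto
    show "(\<lambda>((x, y), (x', y')).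
            ennreal (\<bar>mdist X x x' powr p - mdist Y y y' powr p\<bar> powr (1 / p))) z
        \<le> (SUP ((x, y), (x', y')) \<in> R \<times> R.
            ennreal (\<bar>mdist X' x x' powr p - mdist Y y y' powr p\<bar> powr (1 / p)))"
      by (rule SUP_upper2[of "((f a, b), (f a', b'))"]) (use z f(2) in auto)
  qed
  then show "(INF R \<in> {R. correspondence R (mspace X) (mspace Y)}.
      SUP ((x, y), (x', y')) \<in> R \<times> R.
          ennreal (\<bar>mdist X x x' powr p - mdist Y y y' powr p\<bar> powr (1 / p)))
      \<le> (SUP ((x, y), (x', y')) \<in> R \<times> R.
          ennreal (\<bar>mdist X' x x' powr p - mdist Y y y' powr p\<bar> powr (1 / p)))"
    by (intro INF_lower2[of ?S]) (use S in auto)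
qed auto

lemma dGH_isometric_left:
  assumes "isometric X X'" shows "dGH p X Y = dGH p X' Y"
  using dGH_isometric_left_le[OF assms] dGH_isometric_left_le[OF isometric_sym[OF assms]]
  by (rule antisym)

lemma dGH_Mp_eq:
  assumes "A \<in> Mp p" "B \<in> Mp p" "X \<in> A" "Y \<in> B"
  shows "dGH_Mp p A B = enn2real (dGH p X Y)"
proof -
  have iso: "isometric (SOME X. X \<in> C) Z" if "C \<in> Mp p" "Z \<in> C" for C Z
  proof -
    have "(SOME X. X \<in> C) \<in> C" using that(2) by (rule someI)
    then show ?thesis
      using quotient_eq_iff[OF equiv_isometric that(1)[unfolded Mp_def] that(1)[unfolded Mp_def]]
        that(2) by auto
  qed
  show ?thesis unfolding dGH_Mp_def
    using dGH_isometric_left[OF iso[OF assms(1,3)], of p "SOME Y. Y \<in> B"]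
      dGH_isometric_left[OF iso[OF assms(2,4)], of p X] dGH_commute[of p] by metis
qed

lemma dGH_finite:
  fixes X :: "'a metric" and Y :: "'b metric"
  assumes p: "1 \<le> p" and ne: "mspace X \<noteq> {}" "mspace Y \<noteq> {}"
    and comp: "compact_space (mtopology_of X)" "compact_space (mtopology_of Y)"
  shows "dGH p X Y < \<infinity>"
proof -
  have bdd: "\<exists>D. \<forall>x\<in>mspace Z. \<forall>y\<in>mspace Z. mdist Z x y \<le> D"
    if "compact_space (mtopology_of Z)" for Z :: "'c metric"
  proof -
    interpret Z: Metric_space "mspace Z" "mdist Z" by (rule Metric_space_mspace_mdist)
    have "Z.mbounded (mspace Z)"
      using that Z.compactin_imp_mbounded[of "mspace Z"]
      by (simp add: compact_space_def mtopology_of_def)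
    then show ?thesis unfolding Z.mbounded_alt by blast
  qed
  obtain D where D: "\<And>x y. x \<in> mspace X \<Longrightarrow> y \<in> mspace X \<Longrightarrow> mdist X x y \<le> D"
    using bdd[OF comp(1)] by blast
  obtain E where E: "\<And>x y. x \<in> mspace Y \<Longrightarrow> y \<in> mspace Y \<Longrightarrow> mdist Y x y \<le> E"
    using bdd[OF comp(2)] by blast
  let ?C = "(D powr p + E powr p) powr (1 / p)"
  have c: "correspondence (mspace X \<times> mspace Y) (mspace X) (mspace Y)"
    using ne by (auto simp: correspondence_def)
  have "(SUP ((x, y), (x', y')) \<in> (mspace X \<times> mspace Y) \<times> (mspace X \<times> mspace Y).
          ennreal (\<bar>mdist X x x' powr p - mdist Y y y' powr p\<bar> powr (1 / p))) \<le> ennreal ?C"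
  proof (rule SUP_least)
    fix z assume "z \<in> (mspace X \<times> mspace Y) \<times> (mspace X \<times> mspace Y)"
    then obtain a b a' b' where z: "z = ((a, b), (a', b'))" "a \<in> mspace X" "a' \<in> mspace X"
      "b \<in> mspace Y" "b' \<in> mspace Y" by auto
    have 1: "mdist X a a' powr p \<le> D powr p" "mdist Y b b' powr p \<le> E powr p"
      using D E z p by (auto intro!: powr_mono2)
    have 2: "0 \<le> mdist X a a' powr p" "0 \<le> mdist Y b b' powr p" by auto
    have "\<bar>mdist X a a' powr p - mdist Y b b' powr p\<bar> \<le> D powr p + E powr p"
      using 1 2 by linarith
    then have "\<bar>mdist X a a' powr p - mdist Y b b' powr p\<bar> powr (1 / p) \<le> ?C"
      using p by (intro powr_mono2) auto
    then show "(\<lambda>((x, y), (x', y')).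
        ennreal (\<bar>mdist X x x' powr p - mdist Y y y' powr p\<bar> powr (1 / p))) z \<le> ennreal ?C"
      using z by (auto intro: ennreal_leI)
  qed
  then have "(INF R \<in> {R. correspondence R (mspace X) (mspace Y)}.
        SUP ((x, y), (x', y')) \<in> R \<times> R.
          ennreal (\<bar>mdist X x x' powr p - mdist Y y y' powr p\<bar> powr (1 / p))) \<le> ennreal ?C"
    by (intro INF_lower2[of "mspace X \<times> mspace Y"]) (use c in auto)
  then have "(INF R \<in> {R. correspondence R (mspace X) (mspace Y)}.
        SUP ((x, y), (x', y')) \<in> R \<times> R.
          ennreal (\<bar>mdist X x x' powr p - mdist Y y y' powr p\<bar> powr (1 / p))) < top"
    by (rule order_le_less_trans) simp
  then have "dGH p X Y < top"
    unfolding dGH_def by (intro ennreal_mult_less_top[THEN iffD2]) auto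
  then show ?thesis by simp
qed

lemma compact_metric_real_copy:
  fixes X :: "'a metric"
  assumes "compact_space (mtopology_of X)"
  shows "\<exists>Y :: real metric. isometric X Y"
proof -
  interpret X: Metric_space "mspace X" "mdist X" by (rule Metric_space_mspace_mdist)
  have tb: "X.mtotally_bounded (mspace X)"
    using assms X.compactin_imp_mtotally_bounded[of "mspace X"]
    by (simp add: compact_space_def mtopology_of_def)
  then have "\<exists>K. finite K \<and> K \<subseteq> mspace X \<and> mspace X \<subseteq> (\<Union>x\<in>K. X.mball x (inverse (Suc n)))" for n :: nat
    unfolding X.mtotally_bounded_def by (meson inverse_positive_iff_positive of_nat_0_less_iff zero_less_Suc)
  then obtain K where K: "\<And>n :: nat. finite (K n)" "\<And>n. K n \<subseteq> mspace X"
    "\<And>n. mspace X \<subseteq> (\<Union>x\<in>K n. X.mball x (inverse (Suc n)))" by metis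
  define Q where "Q = (\<Union>n. K n)"
  have Q: "countable Q" "Q \<subseteq> mspace X" unfolding Q_def using K by (auto intro: countable_finite)
  have dense: "\<exists>q\<in>Q. mdist X q x < e" if x: "x \<in> mspace X" "e > 0" for x e
  proof -
    obtain n where n: "inverse (real (Suc n)) < e" using reals_Archimedean \<open>e > 0\<close> by blast
    obtain q where "q \<in> K n" "mdist X q x < inverse (Suc n)" using K(3)[of n] x(1)
      unfolding X.mball_def by blast
    then show ?thesis using n unfolding Q_def by (meson UN_I UNIV_I order_less_trans)
  qed
  define code :: "'a \<Rightarrow> nat set" where
    "code x = to_nat_on (Q \<times> (UNIV :: nat set)) ` {(q, n). q \<in> Q \<and> mdist X q x < inverse (Suc n)}" for x
  have code: "inj_on code (mspace X)"
  proof (rule inj_onI, rule ccontr)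
    fix x y assume xy: "x \<in> mspace X" "y \<in> mspace X" "code x = code y" "x \<noteq> y"
    have inj: "inj_on (to_nat_on (Q \<times> (UNIV :: nat set))) (Q \<times> UNIV)"
      using Q(1) by (intro inj_on_to_nat_on) auto
    have eq: "{(q, n :: nat). q \<in> Q \<and> mdist X q x < inverse (Suc n)}
            = {(q, n). q \<in> Q \<and> mdist X q y < inverse (Suc n)}"
      using xy(3) unfolding code_def by (subst (asm) inj_on_image_eq_iff[OF inj]) auto
    have "mdist X x y > 0" using xy by simp
    then obtain n where n: "inverse (real (Suc n)) < mdist X x y / 2"
      using reals_Archimedean[of "mdist X x y / 2"] by auto
    obtain q where q: "q \<in> Q" "mdist X q x < inverse (Suc n)"
      using dense[of x "inverse (Suc n)"] xy by auto
    then have "mdist X q y < inverse (Suc n)" using eq by auto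
    moreover have "mdist X x y \<le> mdist X q x + mdist X q y"
      using X.triangle''[of q x y] X.triangle[of x q y] X.commute[of x q] q Q xy by auto
    ultimately show False using q n by linarith
  qed
  obtain g :: "nat set \<Rightarrow> real" where g: "inj g"
    using nat_sets_eqpoll_reals unfolding eqpoll_def bij_betw_def by blast
  define h where "h = g \<circ> code"
  have h: "inj_on h (mspace X)" unfolding h_def using code g by (simp add: comp_inj_on inj_on_subset)
  let ?k = "inv_into (mspace X) h"
  let ?d = "\<lambda>a b. mdist X (?k a) (?k b)"
  have k: "?k a \<in> mspace X" if "a \<in> h ` mspace X" for a using that by (rule inv_into_into)
  have ms: "Metric_space (h ` mspace X) ?d"
  proof
    show "?d a b = 0 \<longleftrightarrow> a = b" if "a \<in> h ` mspace X" "b \<in> h ` mspace X" for a b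
      using X.zero[OF k[OF that(1)] k[OF that(2)]] inv_into_injective[of "mspace X" h a b] that
      by auto
    show "?d a c \<le> ?d a b + ?d b c"
      if "a \<in> h ` mspace X" "b \<in> h ` mspace X" "c \<in> h ` mspace X" for a b c
      using X.triangle k that by blast
  qed (auto simp: X.commute)
  have "isometric X (metric (h ` mspace X, ?d))"
    unfolding isometric_def
    by (rule exI[of _ h]) (use ms h in \<open>auto simp: Metric_space.mspace_metric Metric_space.mdist_metric bij_betw_def\<close>)
  then show ?thesis by blast
qed

end

(* Write D = d powr p, which is again a metric on a p-metric space. Up to the monotone rescaling
   t |-> (t / 2) powr (1 / p), the distance of X and Y is the infimum of the distortions of D over
   the correspondences, and the triangle inequality comes from composing correspondences.

   Distance 0: Tychonoff's theorem turns correspondences of vanishing distortion into isometric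
   embeddings of X into Y and of Y into X, which are onto by compactness.

   Completeness: given correspondences between X n and X (n + 1) of distortion at most 2^-n, the
   limit consists of the sequences of successively corresponding points.

   Separability: recording a finite net of X and the integer parts of the multiples k D of its
   mutual distances determines X up to an error that tends to 0 as k grows, and there are only
   countably many such records. *)

theory Submission
  imports Defs
begin

subsection \<open>Distortion of correspondences\<close>

text \<open>Comparing \<open>p\<close>-th powers without taking the root makes the bounds add under
  composition. The non-strict inequality survives the passage to closures.\<close>

definition distortion_le :: "real \<Rightarrow> real \<Rightarrow> ('a \<times> 'b) set \<Rightarrow> 'a metric \<Rightarrow> 'b metric \<Rightarrow> bool" where
  "distortion_le p e R X Y \<longleftrightarrow>
     (\<forall>x y x' y'. (x, y) \<in> R \<longrightarrow> (x', y') \<in> R \<longrightarrow>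
        \<bar>mdist X x x' powr p - mdist Y y y' powr p\<bar> \<le> e)"

text \<open>A single correspondence bounds the infimum by \<open>e powr (1 / p)\<close>, and the
  factor \<open>2 powr (- (1 / p))\<close> enters the root as a division by 2.\<close>

lemma dGH_le:
  assumes p: "1 \<le> p" and e: "0 \<le> e"
    and R: "correspondence R (mspace X) (mspace Y)" "distortion_le p e R X Y"
  shows "dGH p X Y \<le> ennreal ((e / 2) powr (1 / p))"
proof -
  have "(SUP ((x, y), (x', y')) \<in> R \<times> R.
          ennreal (\<bar>mdist X x x' powr p - mdist Y y y' powr p\<bar> powr (1 / p)))
        \<le> ennreal (e powr (1 / p))"
    using R(2) p unfolding distortion_le_def
    by (intro SUP_least) (auto intro!: ennreal_leI powr_mono2)
  then have "(INF R \<in> {R. correspondence R (mspace X) (mspace Y)}.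
        SUP ((x, y), (x', y')) \<in> R \<times> R.
          ennreal (\<bar>mdist X x x' powr p - mdist Y y y' powr p\<bar> powr (1 / p)))
        \<le> ennreal (e powr (1 / p))"
    by (intro INF_lower2[of R]) (use R(1) in auto)
  then have "dGH p X Y \<le> ennreal (2 powr (- (1 / p))) * ennreal (e powr (1 / p))"
    unfolding dGH_def by (rule mult_left_mono) simp
  also have "\<dots> = ennreal ((e / 2) powr (1 / p))"
    using e by (simp add: powr_divide powr_minus field_simps flip: ennreal_mult)
  finally show ?thesis .
qed

text \<open>Converse of \<open>dGH_le\<close>: the distortion \<open>2 * t powr p\<close> solves
  \<open>(e / 2) powr (1 / p) = t\<close> for \<open>e\<close>. The strict bound yields a
  correspondence without any claim that the infimum is attained.\<close>

lemma dGH_lessD: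
  assumes p: "1 \<le> p" and less: "dGH p X Y < ennreal t"
  obtains R where "correspondence R (mspace X) (mspace Y)"
    "distortion_le p (2 * t powr p) R X Y"
proof -
  let ?S = "\<lambda>R. SUP ((x, y), (x', y')) \<in> R \<times> R.
          ennreal (\<bar>mdist X x x' powr p - mdist Y y y' powr p\<bar> powr (1 / p))"
  let ?I = "INF R \<in> {R. correspondence R (mspace X) (mspace Y)}. ?S R"
  \<comment> \<open>\<open>ennreal\<close> sends nonpositive reals to 0, which nothing is strictly
    below.\<close>
  have t: "0 < t" using less by (metis ennreal_less_zero_iff le_less_trans zero_le)
  have "?I < ennreal (2 powr (1 / p) * t)"
  proof (rule ccontr)
    assume "\<not> ?thesis"
    then have "ennreal (2 powr (1 / p) * t) \<le> ?I" by simp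
    then have "ennreal (2 powr (- (1 / p))) * ennreal (2 powr (1 / p) * t) \<le> dGH p X Y"
      unfolding dGH_def by (rule mult_left_mono) simp
    moreover have "ennreal (2 powr (- (1 / p))) * ennreal (2 powr (1 / p) * t) = ennreal t"
      using t by (simp add: powr_minus flip: ennreal_mult)
    ultimately show False using less by simp
  qed
  then obtain R where R: "correspondence R (mspace X) (mspace Y)" "?S R < ennreal (2 powr (1 / p) * t)"
    by (auto simp: INF_less_iff)
  have "distortion_le p (2 * t powr p) R X Y"
    unfolding distortion_le_def
  proof (intro allI impI)
    fix x y x' y' assume xy: "(x, y) \<in> R" "(x', y') \<in> R"
    let ?a = "\<bar>mdist X x x' powr p - mdist Y y y' powr p\<bar>"
    have "ennreal (?a powr (1 / p)) \<le> ?S R"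
      by (rule SUP_upper2[of "((x, y), (x', y'))"]) (use xy in auto)
    then have "ennreal (?a powr (1 / p)) < ennreal (2 powr (1 / p) * t)" using R(2) by simp
    then have "?a powr (1 / p) \<le> 2 powr (1 / p) * t" by (simp add: ennreal_less_iff)
    then have "(?a powr (1 / p)) powr p \<le> (2 powr (1 / p) * t) powr p"
      using p by (intro powr_mono2) auto
    then show "?a \<le> 2 * t powr p"
      using p t by (simp add: powr_powr powr_mult)
  qed
  then show thesis using R(1) that by blast
qed

lemma correspondence_relcomp:
  assumes "correspondence R A B" "correspondence S B C"
  shows "correspondence (R O S) A C"
proof -
  have R: "R \<subseteq> A \<times> B" "\<And>a. a \<in> A \<Longrightarrow> \<exists>b. (a, b) \<in> R" "\<And>b. b \<in> B \<Longrightarrow> \<exists>a. (a, b) \<in> R"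
    using assms(1) unfolding correspondence_def by force+
  have S: "S \<subseteq> B \<times> C" "\<And>a. a \<in> B \<Longrightarrow> \<exists>b. (a, b) \<in> S" "\<And>b. b \<in> C \<Longrightarrow> \<exists>a. (a, b) \<in> S"
    using assms(2) unfolding correspondence_def by force+
  have "A \<subseteq> fst ` (R O S)"
  proof
    fix a assume "a \<in> A"
    then obtain b where b: "(a, b) \<in> R" using R(2) by blast
    then obtain c where "(b, c) \<in> S" using R(1) S(2) by blast
    with b have "(a, c) \<in> R O S" by blast
    then show "a \<in> fst ` (R O S)" by force
  qed
  moreover have "C \<subseteq> snd ` (R O S)"
  proof
    fix c assume "c \<in> C"
    then obtain b where b: "(b, c) \<in> S" using S(3) by blast
    then obtain a where "(a, b) \<in> R" using S(1) R(3) by blast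
    with b have "(a, c) \<in> R O S" by blast
    then show "c \<in> snd ` (R O S)" by force
  qed
  ultimately show ?thesis
    unfolding correspondence_def using R(1) S(1) by auto
qed

lemma distortion_le_relcomp:
  assumes "distortion_le p e R X Y" "distortion_le p e' S Y Z"
  shows "distortion_le p (e + e') (R O S) X Z"
  unfolding distortion_le_def
proof (intro allI impI)
  fix x z x' z' assume "(x, z) \<in> R O S" "(x', z') \<in> R O S"
  then obtain y y' where "(x, y) \<in> R" "(y, z) \<in> S" "(x', y') \<in> R" "(y', z') \<in> S" by blast
  then have "\<bar>mdist X x x' powr p - mdist Y y y' powr p\<bar> \<le> e"
    "\<bar>mdist Y y y' powr p - mdist Z z z' powr p\<bar> \<le> e'"
    using assms unfolding distortion_le_def by auto
  then show "\<bar>mdist X x x' powr p - mdist Z z z' powr p\<bar> \<le> e + e'" by linarith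
qed

text \<open>Split off one factor from each power and enlarge the remaining bases to
  \<open>s + t\<close>; the exponent \<open>p - 1\<close> is nonnegative.\<close>

lemma powr_add_powr_le:
  fixes s t :: real
  assumes "0 \<le> s" "0 \<le> t" "1 \<le> p"
  shows "s powr p + t powr p \<le> (s + t) powr p"
proof -
  have *: "u powr p = u * u powr (p - 1)" if "0 \<le> u" for u :: real
    using that powr_mult_base[of u "p - 1"] by simp
  have "s * s powr (p - 1) + t * t powr (p - 1) \<le> s * (s + t) powr (p - 1) + t * (s + t) powr (p - 1)"
    using assms by (intro add_mono mult_left_mono powr_mono2) auto
  then show ?thesis using assms by (simp add: * distrib_right)
qed

text \<open>Composing almost optimal correspondences gives the bound
  \<open>(s powr p + t powr p) powr (1 / p)\<close>, which is at most \<open>s + t\<close> by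
  superadditivity of the power. Compactness makes the distances finite, so that
  \<open>enn2real\<close> does not collapse them to 0.\<close>

lemma dGH_triangle:
  fixes X :: "'a metric" and Y :: "'b metric" and Z :: "'c metric"
  assumes p: "1 \<le> p"
    and ne: "mspace X \<noteq> {}" "mspace Y \<noteq> {}" "mspace Z \<noteq> {}"
    and comp: "compact_space (mtopology_of X)" "compact_space (mtopology_of Y)"
      "compact_space (mtopology_of Z)"
  shows "enn2real (dGH p X Z) \<le> enn2real (dGH p X Y) + enn2real (dGH p Y Z)"
proof (rule field_le_epsilon)
  fix e :: real assume e: "0 < e"
  define s where "s = enn2real (dGH p X Y) + e / 2"
  define t where "t = enn2real (dGH p Y Z) + e / 2"
  have pos: "0 < s" "0 < t" using e by (auto simp: s_def t_def add_nonneg_pos)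
  have "dGH p X Y < ennreal s"
    using dGH_finite[OF p ne(1,2) comp(1,2)] e
    unfolding s_def by (cases "dGH p X Y") (auto simp: ennreal_less_iff)
  then obtain R where R: "correspondence R (mspace X) (mspace Y)" "distortion_le p (2 * s powr p) R X Y"
    using dGH_lessD[OF p] by blast
  have "dGH p Y Z < ennreal t"
    using dGH_finite[OF p ne(2,3) comp(2,3)] e
    unfolding t_def by (cases "dGH p Y Z") (auto simp: ennreal_less_iff)
  then obtain S where S: "correspondence S (mspace Y) (mspace Z)" "distortion_le p (2 * t powr p) S Y Z"
    using dGH_lessD[OF p] by blast
  have "dGH p X Z \<le> ennreal (((2 * s powr p + 2 * t powr p) / 2) powr (1 / p))"
    by (rule dGH_le[OF p _ correspondence_relcomp[OF R(1) S(1)] distortion_le_relcomp[OF R(2) S(2)]]) simp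
  also have "\<dots> \<le> ennreal (((s + t) powr p) powr (1 / p))"
    using powr_add_powr_le[of s t p] pos p by (intro ennreal_leI powr_mono2) auto
  also have "\<dots> = ennreal (s + t)" using p pos by (simp add: powr_powr)
  finally have "enn2real (dGH p X Z) \<le> s + t"
    using pos by (simp add: enn2real_leI)
  then show "enn2real (dGH p X Z) \<le> enn2real (dGH p X Y) + enn2real (dGH p Y Z) + e"
    by (simp add: s_def t_def)
qed

section \<open>Continuity of the powers of distances\<close>

lemma mdist_powr_triangle:
  assumes "p_metric_space p X" "x \<in> mspace X" "y \<in> mspace X" "z \<in> mspace X"
  shows "mdist X x z powr p \<le> mdist X x y powr p + mdist X y z powr p"
  using assms unfolding p_metric_space_def by blast

lemma continuous_map_mdist_powr:
  assumes "0 < p" "continuous_map T (mtopology_of X) f" "continuous_map T (mtopology_of X) g"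
  shows "continuous_map T euclideanreal (\<lambda>x. mdist X (f x) (g x) powr p)"
proof -
  \<comment> \<open>Distances lie in the closed half line, where \<open>t powr p\<close> is
    continuous up to 0 because \<open>p\<close> is positive.\<close>
  have "continuous_map T (top_of_set {0..}) (\<lambda>x. mdist X (f x) (g x))"
    using continuous_map_mdist[OF assms(2,3)] by (auto simp: continuous_map_in_subtopology)
  moreover have "continuous_map (top_of_set {0..}) euclideanreal (\<lambda>t. t powr p)"
    using assms(1) continuous_on_powr'[of "{0..}" "\<lambda>t. t" "\<lambda>t. p"] by simp
  ultimately show ?thesis
    using continuous_map_compose[of T "top_of_set {0..}" _ euclideanreal "\<lambda>t. t powr p"]
    by (auto simp: o_def)
qed

text \<open>The four maps are arbitrary so that the lemma covers both evaluations of a variable map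
  at two points and the coordinates of a variable pair of pairs.\<close>

lemma closedin_distortion:
  assumes "0 < p" "continuous_map T (mtopology_of X) f" "continuous_map T (mtopology_of X) f'"
    "continuous_map T (mtopology_of Y) g" "continuous_map T (mtopology_of Y) g'"
  shows "closedin T {t \<in> topspace T.
    \<bar>mdist X (f t) (f' t) powr p - mdist Y (g t) (g' t) powr p\<bar> \<le> e}"
proof -
  have "continuous_map T euclideanreal
     (\<lambda>t. \<bar>mdist X (f t) (f' t) powr p - mdist Y (g t) (g' t) powr p\<bar>)"
    by (intro continuous_map_real_abs continuous_map_diff continuous_map_mdist_powr assms)
  from closedin_continuous_map_preimage[OF this, of "{..e}"] show ?thesis by simp
qed

subsection \<open>Spaces at distance zero\<close>

lemma isometric_map_continuous:
  assumes "\<And>x. x \<in> mspace X \<Longrightarrow> f x \<in> mspace Y"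
    "\<And>x x'. x \<in> mspace X \<Longrightarrow> x' \<in> mspace X \<Longrightarrow> mdist Y (f x) (f x') = mdist X x x'"
  shows "continuous_map (mtopology_of X) (mtopology_of Y) f"
  by (rule Lipschitz_continuous_imp_continuous_map)
    (use assms in \<open>auto simp: Lipschitz_continuous_map_def intro!: exI[of _ 1]\<close>)

lemma compact_space_isometric:
  assumes "isometric X Y" "compact_space (mtopology_of X)"
  shows "compact_space (mtopology_of Y)"
proof -
  obtain f where f: "bij_betw f (mspace X) (mspace Y)"
    "\<And>x x'. x \<in> mspace X \<Longrightarrow> x' \<in> mspace X \<Longrightarrow> mdist Y (f x) (f x') = mdist X x x'"
    using assms(1) unfolding isometric_def by blast
  have "compactin (mtopology_of Y) (f ` mspace X)"
    using assms(2) isometric_map_continuous[of X f Y] f bij_betwE[OF f(1)]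
    by (intro image_compactin[of "mtopology_of X"]) (auto simp: compact_space_def)
  then show ?thesis using f(1) by (simp add: compact_space_def bij_betw_def)
qed

lemma p_metric_space_isometric:
  assumes "isometric X Y" "p_metric_space p X"
  shows "p_metric_space p Y"
proof -
  obtain f where f: "bij_betw f (mspace Y) (mspace X)"
    "\<And>x x'. x \<in> mspace Y \<Longrightarrow> x' \<in> mspace Y \<Longrightarrow> mdist X (f x) (f x') = mdist Y x x'"
    using isometric_sym[OF assms(1)] unfolding isometric_def by blast
  show ?thesis unfolding p_metric_space_def
  proof (intro ballI)
    fix x y z assume xyz: "x \<in> mspace Y" "y \<in> mspace Y" "z \<in> mspace Y"
    then show "mdist Y x z powr p \<le> mdist Y x y powr p + mdist Y y z powr p"
      using mdist_powr_triangle[OF assms(2), of "f x" "f y" "f z"] bij_betwE[OF f(1)] f(2) by simp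
  qed
qed

text \<open>If a point \<open>x\<close> were missed, its distance to the image would bound below all distances
  between points of the orbit of \<open>x\<close>.\<close>

lemma isometric_self_map_surj:
  assumes comp: "compact_space (mtopology_of X)"
    and f: "\<And>x. x \<in> mspace X \<Longrightarrow> f x \<in> mspace X"
    and iso: "\<And>x x'. x \<in> mspace X \<Longrightarrow> x' \<in> mspace X \<Longrightarrow> mdist X (f x) (f x') = mdist X x x'"
  shows "f ` mspace X = mspace X"
proof (rule ccontr)
  interpret X: Metric_space "mspace X" "mdist X" by (rule Metric_space_mspace_mdist)
  have top: "mtopology_of X = X.mtopology" by (simp add: mtopology_of_def)
  assume "f ` mspace X \<noteq> mspace X"
  then obtain x where x: "x \<in> mspace X" "x \<notin> f ` mspace X" using f by blast
  have "compactin X.mtopology (f ` mspace X)"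
    using comp isometric_map_continuous[of X f X] f iso unfolding top
    by (intro image_compactin[of "X.mtopology"]) (auto simp: compact_space_def)
  then have "closedin X.mtopology (f ` mspace X)"
    by (rule compactin_imp_closedin[OF X.Hausdorff_space_mtopology])
  then have "openin X.mtopology (mspace X - f ` mspace X)"
    by (simp add: closedin_def)
  then obtain r where r: "r > 0" "X.mball x r \<subseteq> mspace X - f ` mspace X"
    using x unfolding X.openin_mtopology by blast
  have far: "r \<le> mdist X x (f y)" if "y \<in> mspace X" for y
    using r(2) that f[OF that] x(1) by (force simp: X.in_mball)
  have orbit: "(f ^^ n) y \<in> mspace X" if "y \<in> mspace X" for n y
    using that f by (induction n) auto
  have iso_orbit: "mdist X ((f ^^ n) y) ((f ^^ n) z) = mdist X y z"
    if "y \<in> mspace X" "z \<in> mspace X" for n y z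
    using that iso orbit by (induction n) auto
  have sep: "r \<le> mdist X ((f ^^ m) x) ((f ^^ n) x)" if mn: "m < n" for m n
  proof -
    obtain k where k: "n = m + Suc k" using less_imp_Suc_add[OF mn] by auto
    \<comment> \<open>Cancelling the first \<open>m\<close> iterates leaves the distance from
      \<open>x\<close> to a point of the image, which is at least \<open>r\<close>.\<close>
    have "(f ^^ n) x = (f ^^ m) (f ((f ^^ k) x))" unfolding k by (simp add: funpow_add funpow_swap1)
    then show ?thesis using iso_orbit[OF x(1), of "f ((f ^^ k) x)" m] far orbit x(1) f by simp
  qed
  have "range (\<lambda>n. (f ^^ n) x) \<subseteq> mspace X" using orbit[OF x(1)] by blast
  then obtain l s where ls: "strict_mono s" "limitin X.mtopology ((\<lambda>n. (f ^^ n) x) \<circ> s) l sequentially"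
    using comp unfolding top X.compact_space_sequentially by blast
  then have "X.MCauchy ((\<lambda>n. (f ^^ n) x) \<circ> s)"
    using orbit[OF x(1)] by (intro X.convergent_imp_MCauchy[OF _ ls(2)]) auto
  then obtain N where "\<And>n n'. N \<le> n \<Longrightarrow> N \<le> n' \<Longrightarrow> mdist X ((f ^^ s n) x) ((f ^^ s n') x) < r"
    using r(1) unfolding X.MCauchy_def o_def by metis
  from this[of N "Suc N"] sep[of "s N" "s (Suc N)"] ls(1) show False
    by (simp add: strict_mono_Suc_iff)
qed

text \<open>The maps of distortion at most \<open>inverse (Suc n)\<close> form a decreasing sequence of closed
  nonempty subsets of a product of copies of \<open>Y\<close>, which is compact by Tychonoff's theorem.\<close>

lemma isometric_embedding_of_distortion:
  assumes p: "1 \<le> p" and comp: "compact_space (mtopology_of Y)"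
    and R: "\<And>e. 0 < e \<Longrightarrow> \<exists>R. correspondence R (mspace X) (mspace Y) \<and> distortion_le p e R X Y"
  obtains f where "\<And>x. x \<in> mspace X \<Longrightarrow> f x \<in> mspace Y"
    "\<And>x x'. x \<in> mspace X \<Longrightarrow> x' \<in> mspace X \<Longrightarrow> mdist Y (f x) (f x') = mdist X x x'"
proof -
  define T where "T = product_topology (\<lambda>_. mtopology_of Y) (mspace X)"
  have T: "topspace T = (mspace X \<rightarrow>\<^sub>E mspace Y)" by (simp add: T_def)
  \<comment> \<open>The explicit \<open>topspace T\<close> keeps \<open>C n\<close> inside the
    product even if \<open>mspace X\<close> is empty and the intersection ranges over
    nothing.\<close>
  define C where "C n = topspace T \<inter> (\<Inter>x\<in>mspace X. \<Inter>x'\<in>mspace X. {f \<in> topspace T.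
    \<bar>mdist X x x' powr p - mdist Y (f x) (f x') powr p\<bar> \<le> inverse (Suc n)})" for n :: nat
  have "(\<Inter>n. C n) \<noteq> {}"
  proof (rule compact_space_imp_nest)
    show "compact_space T"
      using comp by (simp add: T_def compact_space_product_topology)
    show "closedin T (C n)" for n
    proof -
      have "closedin T {f \<in> topspace T.
          \<bar>mdist X x x' powr p - mdist Y (f x) (f x') powr p\<bar> \<le> inverse (Suc n)}"
        if "x \<in> mspace X" "x' \<in> mspace X" for x x'
        using p that continuous_map_product_projection[of _ "mspace X" "\<lambda>_. mtopology_of Y"]
        by (intro closedin_distortion) (simp_all add: T_def)
      then have "closedin T (\<Inter>(insert (topspace T) {{f \<in> topspace T.
          \<bar>mdist X x x' powr p - mdist Y (f x) (f x') powr p\<bar> \<le> inverse (Suc n)} | x x'.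
          x \<in> mspace X \<and> x' \<in> mspace X}))"
        by (intro closedin_Inter) auto
      also have "\<Inter>(insert (topspace T) {{f \<in> topspace T.
          \<bar>mdist X x x' powr p - mdist Y (f x) (f x') powr p\<bar> \<le> inverse (Suc n)} | x x'.
          x \<in> mspace X \<and> x' \<in> mspace X}) = C n"
        unfolding C_def by blast
      finally show ?thesis .
    qed
    show "C n \<noteq> {}" for n
    proof -
      obtain R where R: "correspondence R (mspace X) (mspace Y)" "distortion_le p (inverse (Suc n)) R X Y"
        using R[of "inverse (Suc n)"] by auto
      have "\<exists>y. (x, y) \<in> R" if "x \<in> mspace X" for x
        using that R(1) unfolding correspondence_def by force
      then obtain f where f: "\<And>x. x \<in> mspace X \<Longrightarrow> (x, f x) \<in> R" by metis
      then have "f x \<in> mspace Y" if "x \<in> mspace X" for x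
        using that R(1) unfolding correspondence_def by blast
      \<comment> \<open>Any selection from \<open>R\<close> inherits its distortion bound. It is
        restricted because the points of \<open>T\<close> are extensional functions.\<close>
      then have "restrict f (mspace X) \<in> C n"
        using f R(2) unfolding C_def T distortion_le_def by auto
      then show ?thesis by blast
    qed
    show "decseq C"
    proof (rule decseq_SucI)
      fix n
      have "inverse (real (Suc (Suc n))) \<le> inverse (real (Suc n))" by (simp add: field_simps)
      then show "C (Suc n) \<le> C n" unfolding C_def by (blast intro: order_trans)
    qed
  qed
  then obtain f where f: "\<And>n. f \<in> C n" by blast
  show thesis
  proof
    show *: "f x \<in> mspace Y" if "x \<in> mspace X" for x
      using f[of 0] that unfolding C_def T by auto
    show "mdist Y (f x) (f x') = mdist X x x'" if x: "x \<in> mspace X" "x' \<in> mspace X" for x x'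
    proof -
      have "\<bar>mdist X x x' powr p - mdist Y (f x) (f x') powr p\<bar> \<le> inverse (Suc n)" for n
        using f[of n] x unfolding C_def by blast
      then have "\<bar>mdist X x x' powr p - mdist Y (f x) (f x') powr p\<bar> \<le> 0"
        by (intro LIMSEQ_le_const[OF LIMSEQ_inverse_real_of_nat]) auto
      then have "(mdist X x x' powr p) powr (1 / p) = (mdist Y (f x) (f x') powr p) powr (1 / p)" by simp
      then show ?thesis using p by (simp add: powr_powr)
    qed
  qed
qed

text \<open>There are isometric embeddings both ways; their composite is an isometric self-map of
  the compact space \<open>Y\<close>, hence onto, and so the embedding of \<open>X\<close> into
  \<open>Y\<close> is onto.\<close>

lemma dGH_eq_0_imp_isometric:
  fixes X :: "'a metric" and Y :: "'b metric"
  assumes p: "1 \<le> p" and comp: "compact_space (mtopology_of X)" "compact_space (mtopology_of Y)"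
    and eq: "dGH p X Y = 0"
  shows "isometric X Y"
proof -
  \<comment> \<open>Stated with fresh types, because it is applied to the pair in both
    orders.\<close>
  have R: "\<exists>R. correspondence R (mspace X) (mspace Y) \<and> distortion_le p e R X Y"
    if e: "0 < e" and eq: "dGH p X Y = 0" for e and X :: "'c metric" and Y :: "'d metric"
  proof -
    have "dGH p X Y < ennreal ((e / 2) powr (1 / p))" using e eq by simp
    moreover have "2 * ((e / 2) powr (1 / p)) powr p = e" using e p by (simp add: powr_powr)
    ultimately show ?thesis using dGH_lessD[OF p, of X Y "(e / 2) powr (1 / p)"] by metis
  qed
  obtain f where f: "\<And>x. x \<in> mspace X \<Longrightarrow> f x \<in> mspace Y"
    "\<And>x x'. x \<in> mspace X \<Longrightarrow> x' \<in> mspace X \<Longrightarrow> mdist Y (f x) (f x') = mdist X x x'"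
    using isometric_embedding_of_distortion[OF p comp(2) R[OF _ eq]] by blast
  obtain g where g: "\<And>y. y \<in> mspace Y \<Longrightarrow> g y \<in> mspace X"
    "\<And>y y'. y \<in> mspace Y \<Longrightarrow> y' \<in> mspace Y \<Longrightarrow> mdist X (g y) (g y') = mdist Y y y'"
    using isometric_embedding_of_distortion[OF p comp(1) R[OF _ eq[unfolded dGH_commute[of p X]]]]
    by blast
  have "(f \<circ> g) ` mspace Y = mspace Y"
    by (rule isometric_self_map_surj[OF comp(2)]) (use f g in auto)
  then have "mspace Y = f ` g ` mspace Y" by (simp add: image_comp)
  moreover have "g ` mspace Y \<subseteq> mspace X" using g(1) by blast
  ultimately have "f ` mspace X = mspace Y" using f(1) by blast
  moreover have "inj_on f (mspace X)"
    by (rule inj_onI) (metis f mdist_zero)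
  ultimately show ?thesis unfolding isometric_def bij_betw_def using f(2) by blast
qed

subsection \<open>Limits of closed correspondences\<close>

text \<open>The closure of \<open>R\<close> serves: the distortion bound is a closed condition on
  pairs of pairs, and the closure of \<open>R \<times> R\<close> is the product of the
  closures.\<close>

lemma closed_correspondence:
  assumes p: "1 \<le> p"
    and R: "correspondence R (mspace X) (mspace Y)" "distortion_le p e R X Y"
  obtains S where "closedin (prod_topology (mtopology_of X) (mtopology_of Y)) S"
    "correspondence S (mspace X) (mspace Y)" "distortion_le p e S X Y"
proof
  let ?P = "prod_topology (mtopology_of X) (mtopology_of Y)"
  let ?S = "?P closure_of R"
  show "closedin ?P ?S" by simp
  have RS: "R \<subseteq> ?S" using R(1) by (intro closure_of_subset) (auto simp: correspondence_def)
  have S: "?S \<subseteq> mspace X \<times> mspace Y" using closure_of_subset_topspace[of ?P R] by simp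
  have "fst ` R \<subseteq> fst ` ?S" "snd ` R \<subseteq> snd ` ?S" using RS by (auto intro: image_mono)
  then show "correspondence ?S (mspace X) (mspace Y)"
    using S R(1) unfolding correspondence_def by auto
  let ?C = "{t \<in> topspace (prod_topology ?P ?P).
    \<bar>mdist X (fst (fst t)) (fst (snd t)) powr p - mdist Y (snd (fst t)) (snd (snd t)) powr p\<bar> \<le> e}"
  have "closedin (prod_topology ?P ?P) ?C"
    using p
    by (intro closedin_distortion continuous_map_fst_of continuous_map_snd_of
        continuous_map_compose[OF continuous_map_fst, unfolded o_def]
        continuous_map_compose[OF continuous_map_snd, unfolded o_def]
        continuous_map_fst continuous_map_snd) auto
  moreover have "R \<times> R \<subseteq> ?C"
    using R by (auto simp: distortion_le_def correspondence_def)
  ultimately have "prod_topology ?P ?P closure_of (R \<times> R) \<subseteq> ?C"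
    by (intro closure_of_minimal)
  then have "?S \<times> ?S \<subseteq> ?C" by (simp add: closure_of_Times)
  then show "distortion_le p e ?S X Y"
    unfolding distortion_le_def by fastforce
qed

text \<open>Follow the correspondences forwards from \<open>x\<close> by dependent choice and
  backwards by induction on \<open>n\<close>. Hence the threads will project onto every space of the
  sequence.\<close>

lemma thread_through:
  assumes S: "\<And>n :: nat. correspondence (S n) (A n) (A (Suc n))" and x: "x \<in> A n"
  obtains t where "t n = x" "\<And>m. (t m, t (Suc m)) \<in> S m"
proof -
  have fwd: "\<exists>z. (y, z) \<in> S m \<and> z \<in> A (Suc m)" if "y \<in> A m" for y m
    using that S[of m] unfolding correspondence_def by force
  have bwd: "\<exists>y. (y, z) \<in> S m \<and> y \<in> A m" if "z \<in> A (Suc m)" for z m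
    using that S[of m] unfolding correspondence_def by force
  have "\<exists>g. \<forall>k. (g k \<in> A (n + k) \<and> (k = 0 \<longrightarrow> g k = x)) \<and> (g k, g (Suc k)) \<in> S (n + k)"
    by (rule dependent_nat_choice) (use x fwd in auto)
  then obtain g where g: "g 0 = x" "\<And>k. (g k, g (Suc k)) \<in> S (n + k)" by blast
  have "\<exists>b. b n = x \<and> (\<forall>m<n. (b m, b (Suc m)) \<in> S m)"
    using x
  proof (induction n arbitrary: x)
    case (Suc n)
    obtain y where y: "(y, x) \<in> S n" "y \<in> A n" using bwd Suc.prems by blast
    obtain b where "b n = y" "\<And>m. m < n \<Longrightarrow> (b m, b (Suc m)) \<in> S m" using Suc.IH[OF y(2)] by blast
    then show ?case using y(1)
      by (intro exI[of _ "b(Suc n := x)"]) (auto simp: less_Suc_eq)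
  qed auto
  then obtain b where b: "b n = x" "\<And>m. m < n \<Longrightarrow> (b m, b (Suc m)) \<in> S m" by blast
  \<comment> \<open>The two pieces agree at index \<open>n\<close>, where \<open>b n\<close> and
    \<open>g 0\<close> are both \<open>x\<close>, so the step from \<open>n\<close> to
    \<open>Suc n\<close> already belongs to \<open>g\<close>.\<close>
  let ?t = "\<lambda>m. if m \<le> n then b m else g (m - n)"
  show thesis
  proof (rule that[of ?t])
    show "?t n = x" using b by simp
    show "(?t m, ?t (Suc m)) \<in> S m" for m
    proof (cases "m < n")
      case True
      then show ?thesis using b(2) by simp
    next
      case False
      then obtain k where "m = n + k" using le_Suc_ex by (metis not_less)
      then show ?thesis using g(1) g(2)[of k] b(1) by (cases k) (auto simp: Suc_diff_le)
    qed
  qed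
qed

text \<open>The quotient by \<open>d x y = 0\<close> is realised on chosen representatives, so its
  points keep the type of those of \<open>T\<close>. The assumption \<open>cont\<close> makes the
  projection continuous, and compactness passes to its image.\<close>

lemma compact_pseudometric_quotient:
  fixes T :: "'a topology"
  assumes comp: "compact_space T"
    and nonneg: "\<And>x y. 0 \<le> d x y" and comm: "\<And>x y. d x y = d y x"
    and refl: "\<And>x. x \<in> topspace T \<Longrightarrow> d x x = 0"
    and tri: "\<And>x y z. x \<in> topspace T \<Longrightarrow> y \<in> topspace T \<Longrightarrow> z \<in> topspace T \<Longrightarrow> d x z \<le> d x y + d y z"
    and cont: "\<And>x e. x \<in> topspace T \<Longrightarrow> 0 < e \<Longrightarrow> \<exists>U. openin T U \<and> x \<in> U \<and> (\<forall>y\<in>U. d x y < e)"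
  obtains Y :: "'a metric" and r where "r ` topspace T = mspace Y" "compact_space (mtopology_of Y)"
    "\<And>x y. x \<in> topspace T \<Longrightarrow> y \<in> topspace T \<Longrightarrow> mdist Y (r x) (r y) = d x y"
proof -
  \<comment> \<open>All points of a class satisfy the same choice predicate, so \<open>r\<close>
    takes one value on each class.\<close>
  define r where "r x = (SOME y. y \<in> topspace T \<and> d x y = 0)" for x
  have r: "r x \<in> topspace T" "d x (r x) = 0" if "x \<in> topspace T" for x
    using someI[of "\<lambda>y. y \<in> topspace T \<and> d x y = 0" x] refl[OF that] that unfolding r_def by auto
  have r_eq: "r x = r y" if "x \<in> topspace T" "y \<in> topspace T" "d x y = 0" for x y
  proof -
    have "d x z = 0 \<longleftrightarrow> d y z = 0" if z: "z \<in> topspace T" for z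
      using tri[of x y z] tri[of y x z] nonneg[of x z] nonneg[of y z] comm[of x y] that z
        \<open>x \<in> topspace T\<close> \<open>y \<in> topspace T\<close> \<open>d x y = 0\<close> by auto
    then show ?thesis unfolding r_def by metis
  qed
  have d_r: "d (r x) (r y) = d x y" if "x \<in> topspace T" "y \<in> topspace T" for x y
    using tri[of x "r x" y] tri[of "r x" "r y" y] tri[of "r x" x "r y"] tri[of x y "r y"]
      r[OF that(1)] r[OF that(2)] comm[of x "r x"] comm[of y "r y"] that by auto
  let ?Q = "r ` topspace T"
  have Q: "?Q \<subseteq> topspace T" using r by blast
  interpret Q: Metric_space ?Q d
  proof
    show "d x y = 0 \<longleftrightarrow> x = y" if xy: "x \<in> ?Q" "y \<in> ?Q" for x y
    proof
      assume "d x y = 0"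
      moreover obtain a b where ab: "a \<in> topspace T" "b \<in> topspace T" "x = r a" "y = r b" using xy by blast
      ultimately show "x = y" using d_r r_eq by metis
    qed (use refl xy Q in auto)
    show "d x z \<le> d x y + d y z" if "x \<in> ?Q" "y \<in> ?Q" "z \<in> ?Q" for x y z
      using that Q tri by blast
  qed (use nonneg comm in auto)
  have "continuous_map T Q.mtopology r"
    unfolding Q.continuous_map_to_metric
  proof (intro ballI allI impI)
    fix x and e :: real assume x: "x \<in> topspace T" "0 < e"
    then obtain U where U: "openin T U" "x \<in> U" "\<forall>y\<in>U. d x y < e" using cont by blast
    moreover have "U \<subseteq> topspace T" using U(1) by (rule openin_subset)
    ultimately have "\<forall>y\<in>U. r y \<in> Q.mball (r x) e"
      using x d_r by (auto simp: Q.in_mball subset_iff)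
    then show "\<exists>U. openin T U \<and> x \<in> U \<and> (\<forall>y\<in>U. r y \<in> Q.mball (r x) e)" using U by blast
  qed
  then have "compactin Q.mtopology ?Q"
    using comp by (intro image_compactin[of T]) (auto simp: compact_space_def)
  then have "compact_space Q.mtopology" by (simp add: compact_space_def)
  then show thesis
    using that[of r "metric (?Q, d)"] d_r by simp
qed

lemma telescoping_bound:
  fixes D :: "nat \<Rightarrow> real"
  assumes "\<And>n. \<bar>D n - D (Suc n)\<bar> \<le> (1 / 2) ^ n"
  shows "convergent D" and "\<bar>D n - lim D\<bar> \<le> 2 * (1 / 2) ^ n"
proof -
  \<comment> \<open>The subtracted term lets the induction close: one more step consumes exactly
    \<open>(1 / 2) ^ (n + k)\<close>.\<close>
  have "\<bar>D n - D (n + k)\<bar> \<le> 2 * (1 / 2) ^ n - 2 * (1 / 2) ^ (n + k)" for n k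
  proof (induction k)
    case (Suc k)
    have "(1 / 2 :: real) ^ (n + Suc k) = (1 / 2) ^ (n + k) / 2" by simp
    then show ?case using Suc assms[of "n + k"] unfolding add_Suc_right by linarith
  qed simp
  then have le: "\<bar>D n - D (n + k)\<bar> \<le> 2 * (1 / 2) ^ n" for n k
    by (smt (verit) zero_le_power divide_nonneg_nonneg)
  show "convergent D"
  proof (rule Cauchy_convergent, rule metric_CauchyI)
    fix e :: real assume "0 < e"
    then obtain N where N: "(1 / 2) ^ N < e / 4"
      using real_arch_pow_inv[of "e / 4" "1 / 2"] by auto
    have "dist (D m) (D n) < e" if "N \<le> m" "N \<le> n" for m n
      using le[of N "m - N"] le[of N "n - N"] N that by (simp add: dist_real_def)
    then show "\<exists>M. \<forall>m\<ge>M. \<forall>n\<ge>M. dist (D m) (D n) < e" by blast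
  qed
  then have "D \<longlonglongrightarrow> lim D" by (simp add: convergent_LIMSEQ_iff)
  then have "(\<lambda>k. \<bar>D n - D (k + n)\<bar>) \<longlonglongrightarrow> \<bar>D n - lim D\<bar>"
    by (intro tendsto_intros LIMSEQ_ignore_initial_segment)
  then show "\<bar>D n - lim D\<bar> \<le> 2 * (1 / 2) ^ n"
    by (rule LIMSEQ_le_const2) (metis le add.commute)
qed

text \<open>The limit space consists of the threads \<open>t\<close> with \<open>(t n, t (Suc n))\<close> in the \<open>n\<close>-th
  correspondence. When the correspondences are closed, the threads form a closed subset of the
  compact product of the \<open>X n\<close>, so that no metric completion is required.\<close>

lemma compact_limit_of_correspondences:
  fixes X :: "nat \<Rightarrow> 'a metric"
  assumes p: "1 \<le> p"
    and ne: "\<And>n. mspace (X n) \<noteq> {}"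
    and comp: "\<And>n. compact_space (mtopology_of (X n))"
    and pm: "\<And>n. p_metric_space p (X n)"
    and R: "\<And>n. correspondence (R n) (mspace (X n)) (mspace (X (Suc n)))"
      "\<And>n. distortion_le p ((1 / 2) ^ n) (R n) (X n) (X (Suc n))"
  obtains Y :: "(nat \<Rightarrow> 'a) metric" where "mspace Y \<noteq> {}" "compact_space (mtopology_of Y)"
    "p_metric_space p Y"
    "\<And>n. \<exists>S. correspondence S (mspace (X n)) (mspace Y) \<and> distortion_le p (2 * (1 / 2) ^ n) S (X n) Y"
proof -
  have "\<exists>S. closedin (prod_topology (mtopology_of (X n)) (mtopology_of (X (Suc n)))) S \<and>
      correspondence S (mspace (X n)) (mspace (X (Suc n))) \<and>
      distortion_le p ((1 / 2) ^ n) S (X n) (X (Suc n))" for n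
    using closed_correspondence[OF p R[of n]] by blast
  then obtain S where
    S_closed: "\<And>n. closedin (prod_topology (mtopology_of (X n)) (mtopology_of (X (Suc n)))) (S n)"
    and S_corr: "\<And>n. correspondence (S n) (mspace (X n)) (mspace (X (Suc n)))"
    and S_dis: "\<And>n. distortion_le p ((1 / 2) ^ n) (S n) (X n) (X (Suc n))"
    by metis
  define P where "P = product_topology (\<lambda>n. mtopology_of (X n)) UNIV"
  define Q where "Q = topspace P \<inter> (\<Inter>n. {t \<in> topspace P. (t n, t (Suc n)) \<in> S n})"
  define T where "T = subtopology P Q"
  have proj: "continuous_map P (mtopology_of (X n)) (\<lambda>t. t n)" for n
    unfolding P_def by (rule continuous_map_product_projection) simp
  have "closedin P {t \<in> topspace P. (t n, t (Suc n)) \<in> S n}" for n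
    by (rule closedin_continuous_map_preimage[OF continuous_map_pairedI[OF proj proj] S_closed])
  then have Q_closed: "closedin P Q"
    unfolding Q_def by (intro closedin_Int closedin_INT) auto
  have T: "topspace T = Q" unfolding T_def Q_def by auto
  have "compact_space P" unfolding P_def using comp by (simp add: compact_space_product_topology)
  then have T_comp: "compact_space T"
    unfolding T_def using Q_closed by (intro compact_space_subtopology closedin_compact_space)
  have Q_in: "t n \<in> mspace (X n)" and Q_S: "(t n, t (Suc n)) \<in> S n" if "t \<in> Q" for t n
    using that unfolding Q_def P_def by (auto simp: PiE_iff)
  have Q_I: "t \<in> Q" if "\<And>n. (t n, t (Suc n)) \<in> S n" for t
  proof -
    have "t n \<in> mspace (X n)" for n using that[of n] S_corr[of n] unfolding correspondence_def by blast
    then show ?thesis using that unfolding Q_def P_def by (auto simp: PiE_iff)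
  qed
  have through: "\<exists>t\<in>Q. t n = x" if "x \<in> mspace (X n)" for n x
    using thread_through[of S "\<lambda>n. mspace (X n)", OF S_corr that] Q_I by metis
  define D where "D t t' n = mdist (X n) (t n) (t' n) powr p" for t t' n
  \<comment> \<open>Off \<open>Q\<close> the limit may fail to exist and \<open>L\<close> is then an
    arbitrary value. Nonnegativity and symmetry of \<open>d\<close> still hold for all arguments, as
    the quotient lemma demands.\<close>
  define L where "L t t' = lim (D t t')" for t t'
  define d where "d t t' = \<bar>L t t'\<bar> powr (1 / p)" for t t'
  have step: "\<bar>D t t' n - D t t' (Suc n)\<bar> \<le> (1 / 2) ^ n" if "t \<in> Q" "t' \<in> Q" for t t' n
    using S_dis[of n] Q_S[OF that(1)] Q_S[OF that(2)] unfolding D_def distortion_le_def by blast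
  have D_L: "D t t' \<longlonglongrightarrow> L t t'" if "t \<in> Q" "t' \<in> Q" for t t'
    using telescoping_bound(1)[OF step[OF that]] unfolding L_def by (simp add: convergent_LIMSEQ_iff)
  have D_L_le: "\<bar>D t t' n - L t t'\<bar> \<le> 2 * (1 / 2) ^ n" if "t \<in> Q" "t' \<in> Q" for t t' n
    using telescoping_bound(2)[OF step[OF that]] unfolding L_def .
  have L_nonneg: "0 \<le> L t t'" if "t \<in> Q" "t' \<in> Q" for t t'
    using D_L[OF that] by (rule LIMSEQ_le_const) (auto simp: D_def)
  have d_L: "d t t' powr p = L t t'" if "t \<in> Q" "t' \<in> Q" for t t'
    using L_nonneg[OF that] p by (simp add: d_def powr_powr)
  \<comment> \<open>Convergence of the distances themselves yields the triangle inequality for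
    \<open>d\<close>; the one for \<open>p\<close>-th powers comes later from
    \<open>D_L\<close>.\<close>
  have X_d: "(\<lambda>n. mdist (X n) (t n) (t' n)) \<longlonglongrightarrow> d t t'" if "t \<in> Q" "t' \<in> Q" for t t'
  proof -
    have "(\<lambda>n. D t t' n powr (1 / p)) \<longlonglongrightarrow> L t t' powr (1 / p)"
      using p by (intro tendsto_powr' tendsto_const D_L[OF that]) (auto simp: D_def)
    then show ?thesis using p L_nonneg[OF that] by (simp add: D_def d_def powr_powr)
  qed
  have d_comm: "d t t' = d t' t" for t t'
    unfolding d_def L_def D_def by (simp add: mdist_commute)
  obtain Y :: "(nat \<Rightarrow> 'a) metric" and r where Y: "r ` topspace T = mspace Y"
    "compact_space (mtopology_of Y)"
    "\<And>t t'. t \<in> topspace T \<Longrightarrow> t' \<in> topspace T \<Longrightarrow> mdist Y (r t) (r t') = d t t'"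
  proof (rule compact_pseudometric_quotient[OF T_comp, of d])
    show "d t t = 0" if "t \<in> topspace T" for t
    proof -
      have "D t t = (\<lambda>n. 0)" using p Q_in that T by (auto simp: D_def)
      then show ?thesis by (simp add: d_def L_def limI)
    qed
    show "d t u \<le> d t s + d s u" if "t \<in> topspace T" "s \<in> topspace T" "u \<in> topspace T" for t s u
    proof (rule LIMSEQ_le)
      show "(\<lambda>n. mdist (X n) (t n) (u n)) \<longlonglongrightarrow> d t u" using X_d that T by blast
      show "(\<lambda>n. mdist (X n) (t n) (s n) + mdist (X n) (s n) (u n)) \<longlonglongrightarrow> d t s + d s u"
        using X_d that T by (intro tendsto_add) auto
      show "\<exists>N. \<forall>n\<ge>N. mdist (X n) (t n) (u n) \<le> mdist (X n) (t n) (s n) + mdist (X n) (s n) (u n)"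
        using Q_in that T by (auto intro: mdist_triangle)
    qed
    show "\<exists>U. openin T U \<and> t \<in> U \<and> (\<forall>s\<in>U. d t s < e)" if t: "t \<in> topspace T" "0 < e" for t e
    proof -
      have "0 < e powr p / 4" using t(2) by simp
      then obtain n where n: "(1 / 2) ^ n < e powr p / 4"
        using real_arch_pow_inv[of "e powr p / 4" "1 / 2"] by auto
      \<comment> \<open>One coordinate suffices: \<open>D t s n\<close> is within
        \<open>2 * (1 / 2) ^ n < e powr p / 2\<close> of \<open>L t s\<close>.\<close>
      let ?U = "{s \<in> topspace T. D t s n \<in> {..<e powr p / 2}}"
      have "continuous_map T euclideanreal (\<lambda>s. D t s n)"
        unfolding D_def T_def using p t(1) Q_in T
        by (intro continuous_map_mdist_powr continuous_map_from_subtopology[OF proj]) auto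
      then have "openin T ?U" by (rule openin_continuous_map_preimage) simp
      moreover have "mdist (X n) (t n) (t n) = 0" using t(1) Q_in T by simp
      then have "t \<in> ?U" using t by (simp add: D_def)
      moreover have "d t s < e" if s: "s \<in> ?U" for s
      proof -
        have "L t s < e powr p"
          using D_L_le[of t s n] s t n T by auto
        then have "L t s powr (1 / p) < (e powr p) powr (1 / p)"
          using L_nonneg[of t s] s t T p by (intro powr_less_mono2) auto
        then show ?thesis
          using L_nonneg[of t s] s t T p by (simp add: d_def powr_powr)
      qed
      ultimately show ?thesis by blast
    qed
  qed (use d_comm in \<open>auto simp: d_def\<close>)
  show thesis
  proof
    obtain x where "x \<in> mspace (X 0)" using ne by blast
    then show "mspace Y \<noteq> {}" using through[of x 0] Y(1) T by blast
    show "p_metric_space p Y"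
      unfolding p_metric_space_def
    proof (intro ballI)
      fix x y z assume "x \<in> mspace Y" "y \<in> mspace Y" "z \<in> mspace Y"
      then obtain t s u where tsu: "t \<in> Q" "s \<in> Q" "u \<in> Q" "x = r t" "y = r s" "z = r u"
        unfolding Y(1)[symmetric] T by blast
      have "L t u \<le> L t s + L s u"
      proof (rule LIMSEQ_le)
        show "\<exists>N. \<forall>n\<ge>N. D t u n \<le> D t s n + D s u n"
          unfolding D_def using mdist_powr_triangle[OF pm] Q_in tsu by blast
      qed (use D_L tsu in \<open>auto intro: tendsto_add\<close>)
      then show "mdist Y x z powr p \<le> mdist Y x y powr p + mdist Y y z powr p"
        using tsu Y(3) T d_L by simp
    qed
    show "\<exists>S. correspondence S (mspace (X n)) (mspace Y) \<and> distortion_le p (2 * (1 / 2) ^ n) S (X n) Y" for n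
    proof (intro exI conjI)
      \<comment> \<open>A thread relates its \<open>n\<close>-th coordinate to its class. All of
        \<open>X n\<close> is reached by \<open>through\<close>, and \<open>D_L_le\<close> is the
        distortion bound.\<close>
      let ?S = "(\<lambda>t. (t n, r t)) ` Q"
      show "correspondence ?S (mspace (X n)) (mspace Y)"
        unfolding correspondence_def
      proof (intro conjI)
        show "fst ` ?S = mspace (X n)" using through Q_in by (force simp: image_image)
      qed (use Q_in Y(1) T in \<open>auto simp: image_image\<close>)
      show "distortion_le p (2 * (1 / 2) ^ n) ?S (X n) Y"
        using D_L_le Y(3) T d_L unfolding distortion_le_def D_def by auto
    qed
  qed (rule Y(2))
qed

subsection \<open>Separability and the space of isometry classes\<close>

text \<open>One point from each nonempty fibre of each \<open>code k\<close> gives a countable set.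
  It is dense because points with equal \<open>k\<close>-th code are within \<open>e k\<close>,
  which tends to 0.\<close>

lemma (in Metric_space) separable_space_coding:
  fixes code :: "nat \<Rightarrow> 'a \<Rightarrow> 'c :: countable"
  assumes le: "\<And>k x y. x \<in> M \<Longrightarrow> y \<in> M \<Longrightarrow> code k x = code k y \<Longrightarrow> d x y \<le> e k"
    and e: "e \<longlonglongrightarrow> 0"
  shows "separable_space mtopology"
proof -
  define pick where "pick k c = (SOME x. x \<in> M \<and> code k x = c)" for k c
  have pick: "pick k (code k x) \<in> M" "code k (pick k (code k x)) = code k x" if "x \<in> M" for k x
    using someI[of "\<lambda>y. y \<in> M \<and> code k y = code k x" x] that unfolding pick_def by auto
  let ?C = "\<Union>k. (\<lambda>x. pick k (code k x)) ` M"
  have "countable ((\<lambda>x. pick k (code k x)) ` M)" for k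
    by (simp flip: image_image[of "pick k" "code k"])
  then have "countable ?C" by blast
  moreover have "?C \<subseteq> M" using pick by blast
  moreover have "M \<subseteq> mtopology closure_of ?C"
    unfolding metric_closure_of
  proof safe
    fix x and r :: real assume x: "x \<in> M" "0 < r"
    obtain k where "e k < r"
      using order_tendstoD(2)[OF e x(2)] by (auto simp: eventually_sequentially)
    then have "pick k (code k x) \<in> mball x r"
      using le[of x "pick k (code k x)" k] pick[OF x(1), of k] x(1) by (auto simp: in_mball)
    then show "\<exists>y\<in>?C. y \<in> mball x r" using x(1) by blast
  qed
  ultimately show ?thesis
    unfolding separable_space_def
    by (intro exI[of _ ?C]) (use closure_of_subset_topspace[of mtopology ?C] in auto)
qed

text \<open>Total boundedness with radius \<open>e powr (1 / p)\<close>. The net is a list because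
  distances will be recorded by position.\<close>

lemma finite_powr_net:
  assumes p: "1 \<le> p" and comp: "compact_space (mtopology_of X)" and e: "0 < e"
  obtains xs where "set xs \<subseteq> mspace X"
    "\<And>x. x \<in> mspace X \<Longrightarrow> \<exists>a\<in>set xs. mdist X a x powr p \<le> e"
proof -
  interpret X: Metric_space "mspace X" "mdist X" by (rule Metric_space_mspace_mdist)
  have "X.mtotally_bounded (mspace X)"
    using comp X.compactin_imp_mtotally_bounded[of "mspace X"]
    by (simp add: compact_space_def mtopology_of_def)
  moreover have "0 < e powr (1 / p)" using e by simp
  ultimately obtain K where K: "finite K" "K \<subseteq> mspace X"
    "mspace X \<subseteq> (\<Union>x\<in>K. X.mball x (e powr (1 / p)))"
    unfolding X.mtotally_bounded_def by meson
  obtain xs where xs: "set xs = K" using finite_list[OF K(1)] by blast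
  show thesis
  proof
    fix x assume "x \<in> mspace X"
    then obtain a where a: "a \<in> K" "mdist X a x < e powr (1 / p)" using K(3) by (auto simp: X.in_mball)
    then have "mdist X a x powr p \<le> (e powr (1 / p)) powr p"
      using p by (intro powr_mono2) auto
    then show "\<exists>a\<in>set xs. mdist X a x powr p \<le> e" using a xs p e by (auto simp: powr_powr)
  qed (use K xs in simp)
qed

text \<open>The powers satisfy the triangle inequality, so moving each of the two endpoints costs at
  most \<open>e\<close>.\<close>

lemma mdist_powr_diff_le:
  assumes pm: "p_metric_space p X"
    and in_X: "a \<in> mspace X" "a' \<in> mspace X" "x \<in> mspace X" "x' \<in> mspace X"
    and le: "mdist X a x powr p \<le> e" "mdist X a' x' powr p \<le> e"
  shows "\<bar>mdist X x x' powr p - mdist X a a' powr p\<bar> \<le> 2 * e"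
  using mdist_powr_triangle[OF pm in_X(3,1,4)] mdist_powr_triangle[OF pm in_X(1,2,4)]
    mdist_powr_triangle[OF pm in_X(1,3,2)] mdist_powr_triangle[OF pm in_X(3,4,2)] le
  unfolding mdist_commute[of X x a] mdist_commute[of X x' a'] by linarith

text \<open>Rounding puts the distance matrix into a countable type. Equal entries force the powers
  to be within \<open>inverse (Suc k)\<close>; \<open>Suc\<close> keeps the scale positive at
  \<open>k = 0\<close>.\<close>

definition distance_code :: "real \<Rightarrow> nat \<Rightarrow> 'a metric \<Rightarrow> 'a list \<Rightarrow> int list list" where
  "distance_code p k X xs = map (\<lambda>a. map (\<lambda>b. \<lfloor>real (Suc k) * mdist X a b powr p\<rfloor>) xs) xs"

text \<open>Points are related when they are close to net points of the same index. The factor 5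
  counts 2 in each space for moving both endpoints to the net and 1 for the rounding.\<close>

lemma dGH_le_of_distance_code:
  fixes X :: "'a metric" and Y :: "'b metric"
  assumes p: "1 \<le> p" and pm: "p_metric_space p X" "p_metric_space p Y"
    and xs: "set xs \<subseteq> mspace X"
      "\<And>x. x \<in> mspace X \<Longrightarrow> \<exists>a\<in>set xs. mdist X a x powr p \<le> inverse (Suc k)"
    and ys: "set ys \<subseteq> mspace Y"
      "\<And>y. y \<in> mspace Y \<Longrightarrow> \<exists>b\<in>set ys. mdist Y b y powr p \<le> inverse (Suc k)"
    and code: "distance_code p k X xs = distance_code p k Y ys"
  shows "dGH p X Y \<le> ennreal ((5 * inverse (Suc k) / 2) powr (1 / p))"
proof -
  let ?e = "inverse (real (Suc k))"
  have len: "length xs = length ys"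
    using arg_cong[OF code, of length] by (simp add: distance_code_def)
  have close: "\<bar>mdist X (xs ! i) (xs ! j) powr p - mdist Y (ys ! i) (ys ! j) powr p\<bar> \<le> ?e"
    if "i < length xs" "j < length xs" for i j
  proof -
    have "distance_code p k X xs ! i ! j = distance_code p k Y ys ! i ! j" using code by simp
    then have "\<lfloor>real (Suc k) * mdist X (xs ! i) (xs ! j) powr p\<rfloor>
        = \<lfloor>real (Suc k) * mdist Y (ys ! i) (ys ! j) powr p\<rfloor>"
      using that len by (simp add: distance_code_def del: of_nat_Suc)
    then have "\<bar>real (Suc k) * mdist X (xs ! i) (xs ! j) powr p
        - real (Suc k) * mdist Y (ys ! i) (ys ! j) powr p\<bar> \<le> 1" by linarith
    then have "real (Suc k) * \<bar>mdist X (xs ! i) (xs ! j) powr p - mdist Y (ys ! i) (ys ! j) powr p\<bar> \<le> 1"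
      by (simp add: abs_mult flip: right_diff_distrib del: of_nat_Suc)
    then show ?thesis by (simp add: field_simps del: of_nat_Suc)
  qed
  define R where "R = {(x, y). x \<in> mspace X \<and> y \<in> mspace Y \<and>
    (\<exists>i<length xs. mdist X (xs ! i) x powr p \<le> ?e \<and> mdist Y (ys ! i) y powr p \<le> ?e)}"
  have in_R: "(x, y) \<in> R" if "x \<in> mspace X" "y \<in> mspace Y" "i < length xs"
    "mdist X (xs ! i) x powr p \<le> ?e" "mdist Y (ys ! i) y powr p \<le> ?e" for x y i
    using that unfolding R_def by blast
  have mem: "xs ! i \<in> mspace X" "ys ! i \<in> mspace Y" if "i < length xs" for i
    using that xs(1) ys(1) len nth_mem by (metis subsetD)+
  have self: "mdist X (xs ! i) (xs ! i) powr p \<le> ?e" "mdist Y (ys ! i) (ys ! i) powr p \<le> ?e"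
    if "i < length xs" for i
  proof -
    have "mdist X (xs ! i) (xs ! i) = 0" "mdist Y (ys ! i) (ys ! i) = 0" using mem[OF that] by auto
    then show "mdist X (xs ! i) (xs ! i) powr p \<le> ?e" "mdist Y (ys ! i) (ys ! i) powr p \<le> ?e" by auto
  qed
  have "correspondence R (mspace X) (mspace Y)"
  proof -
    have "mspace X \<subseteq> fst ` R"
    proof
      fix x assume x: "x \<in> mspace X"
      then obtain i where "i < length xs" "mdist X (xs ! i) x powr p \<le> ?e"
        using xs(2) by (metis in_set_conv_nth)
      then have "(x, ys ! i) \<in> R" using x mem self by (intro in_R) auto
      then show "x \<in> fst ` R" by force
    qed
    moreover have "mspace Y \<subseteq> snd ` R"
    proof
      fix y assume y: "y \<in> mspace Y"
      then obtain i where "i < length xs" "mdist Y (ys ! i) y powr p \<le> ?e"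
        using ys(2) len by (metis in_set_conv_nth)
      then have "(xs ! i, y) \<in> R" using y mem self by (intro in_R) auto
      then show "y \<in> snd ` R" by force
    qed
    ultimately show ?thesis unfolding correspondence_def R_def by auto
  qed
  moreover have "distortion_le p (5 * ?e) R X Y"
    unfolding distortion_le_def
  proof (intro allI impI)
    fix x y x' y' assume xy: "(x, y) \<in> R" "(x', y') \<in> R"
    then obtain i j where ij: "i < length xs" "mdist X (xs ! i) x powr p \<le> ?e" "mdist Y (ys ! i) y powr p \<le> ?e"
       "j < length xs" "mdist X (xs ! j) x' powr p \<le> ?e" "mdist Y (ys ! j) y' powr p \<le> ?e"
      unfolding R_def by blast
    have "\<bar>mdist X x x' powr p - mdist X (xs ! i) (xs ! j) powr p\<bar> \<le> 2 * ?e"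
      using xy ij mem by (intro mdist_powr_diff_le[OF pm(1)]) (auto simp: R_def)
    moreover have "\<bar>mdist Y y y' powr p - mdist Y (ys ! i) (ys ! j) powr p\<bar> \<le> 2 * ?e"
      using xy ij mem by (intro mdist_powr_diff_le[OF pm(2)]) (auto simp: R_def)
    ultimately show "\<bar>mdist X x x' powr p - mdist Y y y' powr p\<bar> \<le> 5 * ?e"
      using close[OF ij(1,4)] by linarith
  qed
  ultimately show ?thesis by (intro dGH_le[OF p]) auto
qed

section \<open>The space of isometry classes: metric, completeness, separability\<close>

lemma Mp_representative:
  assumes "A \<in> Mp p"
  shows "(SOME X. X \<in> A) \<in> A" "(SOME X. X \<in> A) \<in> compact_p_metrics p"
proof -
  have "A \<noteq> {}" by (rule in_quotient_imp_non_empty[OF equiv_isometric assms[unfolded Mp_def]])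
  then show *: "(SOME X. X \<in> A) \<in> A" by (simp add: some_in_eq)
  show "(SOME X. X \<in> A) \<in> compact_p_metrics p"
    by (rule subsetD[OF in_quotient_imp_subset[OF equiv_isometric assms[unfolded Mp_def]] *])
qed

lemma Mp_eqI:
  assumes A: "A \<in> Mp p" and B: "B \<in> Mp p" and iso: "isometric (SOME X. X \<in> A) (SOME X. X \<in> B)"
  shows "A = B"
  using quotient_eq_iff[OF equiv_isometric A[unfolded Mp_def] B[unfolded Mp_def]
      Mp_representative(1)[OF A] Mp_representative(1)[OF B]]
    Mp_representative(2)[OF A] Mp_representative(2)[OF B] iso by simp

lemma Metric_space_Mp:
  assumes p: "1 \<le> p"
  shows "Metric_space (Mp p) (dGH_Mp p)"
proof
  show "0 \<le> dGH_Mp p A B" for A B by (simp add: dGH_Mp_def)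
  show "dGH_Mp p A B = dGH_Mp p B A" for A B unfolding dGH_Mp_def by (subst dGH_commute) (rule refl)
  show "dGH_Mp p A B = 0 \<longleftrightarrow> A = B" if AB: "A \<in> Mp p" "B \<in> Mp p" for A B
  proof
    let ?X = "SOME X. X \<in> A" and ?Y = "SOME X. X \<in> B"
    have XY: "?X \<in> compact_p_metrics p" "?Y \<in> compact_p_metrics p"
      by (rule Mp_representative(2)[OF AB(1)], rule Mp_representative(2)[OF AB(2)])
    assume "dGH_Mp p A B = 0"
    \<comment> \<open>\<open>enn2real\<close> also sends infinity to 0, a case that
      \<open>dGH_finite\<close> excludes.\<close>
    then have "dGH p ?X ?Y = 0"
      using dGH_finite[OF p, of ?X ?Y] XY
      by (auto simp: dGH_Mp_def compact_p_metrics_def enn2real_eq_0_iff)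
    then have "isometric ?X ?Y"
      using XY by (intro dGH_eq_0_imp_isometric[OF p]) (auto simp: compact_p_metrics_def)
    then show "A = B" by (rule Mp_eqI[OF AB])
  next
    let ?X = "SOME X. X \<in> A"
    assume "A = B"
    moreover have "dGH p ?X ?X \<le> ennreal ((0 / 2) powr (1 / p))"
      by (rule dGH_le[OF p, of 0 "(\<lambda>x. (x, x)) ` mspace ?X"])
        (auto simp: correspondence_def distortion_le_def image_image)
    ultimately show "dGH_Mp p A B = 0" by (simp add: dGH_Mp_def)
  qed
  show "dGH_Mp p A C \<le> dGH_Mp p A B + dGH_Mp p B C"
    if "A \<in> Mp p" "B \<in> Mp p" "C \<in> Mp p" for A B C
    unfolding dGH_Mp_def
    by (rule dGH_triangle[OF p])
      (use that[THEN Mp_representative(2)] in \<open>auto simp: compact_p_metrics_def\<close>)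
qed

text \<open>A Cauchy sequence converges once a subsequence does. A sufficiently fast subsequence
  admits correspondences of distortion at most \<open>(1 / 2) ^ n\<close> between successive
  representatives, to which the limit construction applies.\<close>

lemma mcomplete_Mp:
  assumes p: "1 \<le> p"
  shows "Metric_space.mcomplete (Mp p) (dGH_Mp p)"
proof -
  interpret M: Metric_space "Mp p" "dGH_Mp p" by (rule Metric_space_Mp[OF p])
  show ?thesis
    unfolding M.mcomplete_def
  proof (intro allI impI)
    fix \<sigma> assume \<sigma>: "M.MCauchy \<sigma>"
    \<comment> \<open>Chosen so that a distance below \<open>e n\<close> gives, through
      \<open>dGH_lessD\<close>, distortion at most \<open>(1 / 2) ^ n\<close>.\<close>
    define e where "e n = ((1 / 2) ^ n / 2) powr (1 / p)" for n :: nat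
    have e: "0 < e n" "2 * e n powr p = (1 / 2) ^ n" for n
      using p by (simp_all add: e_def powr_powr)
    have "\<exists>N. \<forall>m m'. N \<le> m \<longrightarrow> N \<le> m' \<longrightarrow> dGH_Mp p (\<sigma> m) (\<sigma> m') < e n" for n
      using \<sigma> e(1) unfolding M.MCauchy_def by blast
    then obtain N where N: "\<And>n m m'. N n \<le> m \<Longrightarrow> N n \<le> m' \<Longrightarrow> dGH_Mp p (\<sigma> m) (\<sigma> m') < e n"
      by metis
    \<comment> \<open>The sum makes \<open>s n\<close> at least \<open>N n\<close>, and the added
      \<open>n\<close> makes \<open>s\<close> strictly increasing.\<close>
    define s where "s n = (\<Sum>i\<le>n. N i) + n" for n
    have s_mono: "strict_mono s" by (simp add: strict_mono_Suc_iff s_def)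
    have s_ge: "N n \<le> s n" for n
      unfolding s_def by (rule trans_le_add1[OF member_le_sum[of n "{..n}" N]]) auto
    define X where "X n = (SOME X. X \<in> \<sigma> (s n))" for n
    have in_Mp: "\<sigma> n \<in> Mp p" for n using \<sigma> unfolding M.MCauchy_def by blast
    have X: "X n \<in> \<sigma> (s n)" "X n \<in> compact_p_metrics p" for n
      unfolding X_def by (rule Mp_representative[OF in_Mp])+
    have "\<exists>R. correspondence R (mspace (X n)) (mspace (X (Suc n))) \<and>
        distortion_le p ((1 / 2) ^ n) R (X n) (X (Suc n))" for n
    proof -
      have "dGH p (X n) (X (Suc n)) < \<infinity>"
        using X(2)[of n] X(2)[of "Suc n"] by (intro dGH_finite[OF p]) (auto simp: compact_p_metrics_def)
      moreover have "enn2real (dGH p (X n) (X (Suc n))) < e n"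
        using N[of n "s n" "s (Suc n)"] s_ge[of n] strict_monoD[OF s_mono, of n "Suc n"]
        unfolding X_def dGH_Mp_def by simp
      ultimately have "dGH p (X n) (X (Suc n)) < ennreal (e n)"
        by (cases "dGH p (X n) (X (Suc n))") (auto simp: ennreal_less_iff)
      then show ?thesis using dGH_lessD[OF p] unfolding e(2)[symmetric] by blast
    qed
    then obtain R where R: "\<And>n. correspondence (R n) (mspace (X n)) (mspace (X (Suc n)))"
      "\<And>n. distortion_le p ((1 / 2) ^ n) (R n) (X n) (X (Suc n))" by metis
    obtain Y :: "(nat \<Rightarrow> real) metric" where Y: "mspace Y \<noteq> {}" "compact_space (mtopology_of Y)"
      "p_metric_space p Y"
      "\<And>n. \<exists>S. correspondence S (mspace (X n)) (mspace Y) \<and> distortion_le p (2 * (1 / 2) ^ n) S (X n) Y"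
      by (rule compact_limit_of_correspondences[OF p _ _ _ R])
        (use X(2) in \<open>auto simp: compact_p_metrics_def\<close>)
    \<comment> \<open>The points of the limit are sequences of reals, whereas \<open>Mp\<close>
      consists of classes of spaces with real points.\<close>
    obtain Z :: "real metric" where Z: "isometric Y Z" using compact_metric_real_copy[OF Y(2)] by blast
    have "mspace Z \<noteq> {}" using Z Y(1) unfolding isometric_def bij_betw_def by blast
    then have Z_in: "Z \<in> compact_p_metrics p"
      using compact_space_isometric[OF Z Y(2)] p_metric_space_isometric[OF Z Y(3)]
      by (simp add: compact_p_metrics_def)
    define A where "A = {(X, Y). X \<in> compact_p_metrics p \<and> Y \<in> compact_p_metrics p \<and> isometric X Y} `` {Z}"
    have A: "A \<in> Mp p" "Z \<in> A"
      unfolding A_def Mp_def by (rule quotientI[OF Z_in]) (use Z_in isometric_refl in auto)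
    have le: "dGH_Mp p (\<sigma> (s n)) A \<le> ((1 / 2) ^ n) powr (1 / p)" for n
    proof -
      obtain S where "correspondence S (mspace (X n)) (mspace Y)"
        "distortion_le p (2 * (1 / 2) ^ n) S (X n) Y" using Y(4) by blast
      then have "dGH p (X n) Y \<le> ennreal ((2 * (1 / 2) ^ n / 2) powr (1 / p))"
        by (intro dGH_le[OF p]) auto
      moreover have "dGH p (X n) Z = dGH p (X n) Y"
        using dGH_isometric_left[OF Z, of p "X n"] unfolding dGH_commute[of p "X n"] by simp
      ultimately show ?thesis
        unfolding dGH_Mp_eq[OF in_Mp A(1) X(1) A(2)] by (intro enn2real_leI) auto
    qed
    have "(\<lambda>n. ((1 / 2) ^ n :: real) powr (1 / p)) \<longlonglongrightarrow> 0"
      using p by (intro tendsto_zero_powrI[OF LIMSEQ_power_zero tendsto_const]) auto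
    then have "(\<lambda>n. dGH_Mp p (\<sigma> (s n)) A) \<longlonglongrightarrow> 0"
      by (rule tendsto_sandwich[OF _ _ tendsto_const, rotated 2]) (use le in auto)
    then have "limitin M.mtopology (\<sigma> \<circ> s) A sequentially"
      using A(1) in_Mp by (simp add: M.limitin_metric_dist_null)
    then show "\<exists>A. limitin M.mtopology \<sigma> A sequentially"
      using M.MCauchy_convergent_subsequence[OF \<sigma> s_mono] by blast
  qed
qed

text \<open>A class is coded by the rounded distance matrix of a net in its chosen representative,
  an element of the countable type \<open>int list list\<close>.\<close>

lemma separable_space_Mp:
  assumes p: "1 \<le> p"
  shows "separable_space (Metric_space.mtopology (Mp p) (dGH_Mp p))"
proof -
  interpret M: Metric_space "Mp p" "dGH_Mp p" by (rule Metric_space_Mp[OF p])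
  have "\<exists>xs. set xs \<subseteq> mspace X \<and> (\<forall>x\<in>mspace X. \<exists>a\<in>set xs. mdist X a x powr p \<le> inverse (Suc k))"
    if "X \<in> compact_p_metrics p" for X k
  proof -
    have "compact_space (mtopology_of X)" using that by (simp add: compact_p_metrics_def)
    then obtain xs where "set xs \<subseteq> mspace X"
      "\<And>x. x \<in> mspace X \<Longrightarrow> \<exists>a\<in>set xs. mdist X a x powr p \<le> inverse (Suc k)"
      using finite_powr_net[OF p, of X "inverse (Suc k)"] by (metis inverse_Suc)
    then show ?thesis by blast
  qed
  then obtain net where net: "\<And>X k. X \<in> compact_p_metrics p \<Longrightarrow> set (net X k) \<subseteq> mspace X"
    "\<And>X k x. X \<in> compact_p_metrics p \<Longrightarrow> x \<in> mspace X \<Longrightarrow>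
       \<exists>a\<in>set (net X k). mdist X a x powr p \<le> inverse (Suc k)"
    by metis
  let ?code = "\<lambda>k A. distance_code p k (SOME X. X \<in> A) (net (SOME X. X \<in> A) k)"
  let ?e = "\<lambda>k. (5 * inverse (Suc k) / 2) powr (1 / p)"
  show ?thesis
  proof (rule M.separable_space_coding[of ?code ?e])
    fix k A B assume A: "A \<in> Mp p" and B: "B \<in> Mp p" and eq: "?code k A = ?code k B"
    note AB = Mp_representative(2)[OF A] Mp_representative(2)[OF B]
    have "dGH p (SOME X. X \<in> A) (SOME X. X \<in> B) \<le> ennreal (?e k)"
      by (rule dGH_le_of_distance_code[OF p _ _ _ _ _ _ eq])
        (use AB net in \<open>auto simp: compact_p_metrics_def simp del: of_nat_Suc\<close>)
    then show "dGH_Mp p A B \<le> ?e k" unfolding dGH_Mp_def by (intro enn2real_leI) auto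
  next
    have "(\<lambda>k. 5 * inverse (real (Suc k)) / 2) \<longlonglongrightarrow> 5 * 0 / 2"
      by (intro tendsto_intros LIMSEQ_inverse_real_of_nat) simp
    then show "?e \<longlonglongrightarrow> 0"
      using p by (intro tendsto_zero_powrI[OF _ tendsto_const]) auto
  qed
qed

theorem theorem7p13:
  fixes p :: real
  assumes "1 \<le> p"
  shows "Metric_space (Mp p) (dGH_Mp p)
    \<and> Metric_space.mcomplete (Mp p) (dGH_Mp p)
    \<and> separable_space (Metric_space.mtopology (Mp p) (dGH_Mp p))"
  using Metric_space_Mp mcomplete_Mp separable_space_Mp assms by blast

end
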